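(* There exist infinitely many pairwise non-isomorphic graphs $G$ that contain $K_{2,3}$ as a subgraph and satisfy $\Delta(G)\le 4$, $\mathrm{mad}(G)=12/5$, and $\mathrm{lc}(G)=\lceil\Delta(G)/2\rceil+2$.
   Context: Graphs are finite and simple; $\Delta(G)$ is the maximum degree. A linear coloring of $G$ is a proper vertex coloring such that the subgraph induced by the union of each pair of color classes is a linear forest, i.e. a disjoint union of paths (a single vertex counts as a path). The linear chromatic number $\mathrm{lc}(G)$ is the smallest $k$ such that $G$ has a linear coloring with $k$ colors. The maximum average degree is $\mathrm{mad}(G)=\max_{H\subseteq G}\frac{2|E(H)|}{|V(H)|}$, over all nonempty subgraphs $H$ of $G$. *)

theory Defs
  imports Complex_Main "Graph_Theory.Graph_Theory"
begin

text \<open>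
  Finite simple undirected graphs are the graphs of Graph_Theory (locale \<open>graph\<close>,
  or \<open>pair_graph\<close> when arcs are pairs of vertices): finite symmetric digraphs without loops and
  parallel arcs. Every undirected edge \<open>{u, v}\<close> is represented by the two arcs \<open>(u, v)\<close> and
  \<open>(v, u)\<close>, hence the degree of a vertex is its out-degree.
\<close>

definition edges :: "('a, 'b) pre_digraph \<Rightarrow> 'a set set" where
  "edges G = (\<lambda>(u, v). {u, v}) ` arcs_ends G"

text \<open>The maxima below are over nonempty sets as soon as the graph has a vertex.\<close>

definition max_degree :: "('a, 'b) pre_digraph \<Rightarrow> nat" where
  "max_degree G = Max (out_degree G ` verts G)"

definition mad :: "('a, 'b) pre_digraph \<Rightarrow> real" where
  "mad G = Max {2 * real (card (edges H)) / real (card (verts H)) | H.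
                  graph H \<and> subgraph H G \<and> verts H \<noteq> {}}"

definition path_graph :: "('a, 'b) pre_digraph \<Rightarrow> bool" where
  "path_graph P \<longleftrightarrow> graph P \<and>
     (\<exists>xs. xs \<noteq> [] \<and> distinct xs \<and> verts P = set xs \<and>
           arcs_ends P = set (zip xs (tl xs)) \<union> (set (zip xs (tl xs)))\<inverse>)"

definition linear_forest :: "('a, 'b) pre_digraph \<Rightarrow> bool" where
  "linear_forest F \<longleftrightarrow>
     (\<exists>Ps. (\<forall>P\<in>Ps. path_graph P \<and> subgraph P F) \<and>
           pairwise (\<lambda>P Q. verts P \<inter> verts Q = {}) Ps \<and>
           verts F = (\<Union>P\<in>Ps. verts P) \<and> arcs F = (\<Union>P\<in>Ps. arcs P))"

definition proper_coloring :: "('a, 'b) pre_digraph \<Rightarrow> nat \<Rightarrow> ('a \<Rightarrow> nat) \<Rightarrow> bool" where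
  "proper_coloring G k c \<longleftrightarrow>
     (\<forall>v\<in>verts G. c v < k) \<and> (\<forall>(u, v)\<in>arcs_ends G. c u \<noteq> c v)"

definition linear_coloring :: "('a, 'b) pre_digraph \<Rightarrow> nat \<Rightarrow> ('a \<Rightarrow> nat) \<Rightarrow> bool" where
  "linear_coloring G k c \<longleftrightarrow> proper_coloring G k c \<and>
     (\<forall>i<k. \<forall>j<k. i \<noteq> j \<longrightarrow> linear_forest (G \<restriction> {v \<in> verts G. c v = i \<or> c v = j}))"

definition linear_chromatic_number :: "('a, 'b) pre_digraph \<Rightarrow> nat" where
  "linear_chromatic_number G = (LEAST k. \<exists>c. linear_coloring G k c)"

definition contains_K23 :: "('a, 'b) pre_digraph \<Rightarrow> bool" where
  "contains_K23 G \<longleftrightarrow> (\<exists>H. subgraph H G \<and> complete_bipartite_digraph 2 3 H)"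

end

theory Submission
  imports Defs
begin

text \<open>
  The graphs are \<open>K\<^sub>2\<^sub>,\<^sub>3\<close> with \<open>n\<close> isolated vertices added: \<open>\<Delta> = 3\<close>, and the densest subgraph is
  \<open>K\<^sub>2\<^sub>,\<^sub>3\<close> itself. With three colors, either the two vertices of the small side have the same color
  and then two vertices of the other side share a color, which gives a bicolored 4-cycle; or they
  have different colors and then the whole other side has the third color, which gives a
  bicolored claw.
\<close>

section \<open>Linear forests\<close>

text \<open>Indices in the vertex list serve as coordinates, which turns both obstructions below
  into arithmetic. They are cast to \<open>int\<close> so that differences are not truncated and one
  absolute value covers both directions of an arc.\<close>

lemma path_graph_position:
  assumes "path_graph P"
  obtains p :: "'a \<Rightarrow> int" where "inj_on p (verts P)"
    "\<And>u v. (u, v) \<in> arcs_ends P \<Longrightarrow> \<bar>p u - p v\<bar> = 1"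
proof -
  from assms obtain xs where xs: "distinct xs" "verts P = set xs"
    "arcs_ends P = set (zip xs (tl xs)) \<union> (set (zip xs (tl xs)))\<inverse>"
    by (auto simp: path_graph_def)
  define q where "q = the_inv_into {..<length xs} ((!) xs)"
  have inj: "inj_on ((!) xs) {..<length xs}"
    using xs(1) by (simp add: inj_on_nth)
  have q: "q (xs ! i) = i" if "i < length xs" for i
    unfolding q_def using inj that by (simp add: the_inv_into_f_f)
  have step: "q v = Suc (q u)" if "(u, v) \<in> set (zip xs (tl xs))" for u v
    using that by (auto simp: in_set_zip nth_tl q)
  show thesis
  proof
    show "inj_on (\<lambda>v. int (q v)) (verts P)"
      using xs(2) by (auto simp: inj_on_def in_set_conv_nth q)
    show "\<bar>int (q u) - int (q v)\<bar> = 1" if "(u, v) \<in> arcs_ends P" for u v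
      using that step unfolding xs(3) by fastforce
  qed
qed

text \<open>Every arc at \<open>x\<close> lies in some path of the decomposition, and disjointness
  leaves only the path that contains \<open>x\<close>. Hence a path is closed under adjacency, and
  one position function covers a whole claw or cycle.\<close>

lemma linear_forest_component:
  fixes F :: "('a, 'b) pre_digraph"
  assumes "linear_forest F" "v \<in> verts F"
  obtains P :: "('a, 'b) pre_digraph" where "path_graph P" "v \<in> verts P"
    "\<forall>x\<in>verts P. \<forall>y. (x, y) \<in> arcs_ends F \<longrightarrow> (x, y) \<in> arcs_ends P \<and> y \<in> verts P"
proof -
  from assms(1) obtain Ps where Ps: "\<And>P. P \<in> Ps \<Longrightarrow> path_graph P" "\<And>P. P \<in> Ps \<Longrightarrow> subgraph P F"
    "pairwise (\<lambda>P Q. verts P \<inter> verts Q = {}) Ps"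
    "verts F = (\<Union>P\<in>Ps. verts P)" "arcs F = (\<Union>P\<in>Ps. arcs P)"
    by (auto simp: linear_forest_def)
  from assms(2) Ps(4) obtain P where P: "P \<in> Ps" "v \<in> verts P" by auto
  show thesis
  proof
    show "path_graph P" "v \<in> verts P" using P Ps(1) by auto
    show "\<forall>x\<in>verts P. \<forall>y. (x, y) \<in> arcs_ends F \<longrightarrow> (x, y) \<in> arcs_ends P \<and> y \<in> verts P"
    proof (intro ballI allI impI)
      fix x y assume x: "x \<in> verts P" and xy: "(x, y) \<in> arcs_ends F"
      then obtain e where e: "e \<in> arcs F" "tail F e = x" "head F e = y" by auto
      with Ps(5) obtain Q where Q: "Q \<in> Ps" "e \<in> arcs Q" by auto
      have "wf_digraph Q" and ends: "tail Q = tail F" "head Q = head F"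
        using Ps(2)[OF Q(1)] by (auto simp: subgraph_def compatible_def)
      then have "x \<in> verts Q" "y \<in> verts Q"
        using e Q wf_digraph.wellformed by metis+
      moreover have "(x, y) \<in> arcs_ends Q"
        using e Q ends by (auto simp: arcs_ends_conv)
      moreover have "Q = P"
        using Ps(3) P(1) Q(1) x \<open>x \<in> verts Q\<close> by (auto simp: pairwise_def)
      ultimately show "(x, y) \<in> arcs_ends P \<and> y \<in> verts P" by simp
    qed
  qed
qed

text \<open>Only the two positions \<open>p v - 1\<close> and \<open>p v + 1\<close> are available
  to three neighbours of \<open>v\<close>.\<close>

lemma linear_forest_no_claw:
  fixes F :: "('a, 'b) pre_digraph"
  assumes "linear_forest F" "v \<in> verts F"
    "(v, x) \<in> arcs_ends F" "(v, y) \<in> arcs_ends F" "(v, z) \<in> arcs_ends F"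
  shows "x = y \<or> x = z \<or> y = z"
proof -
  obtain P :: "('a, 'b) pre_digraph" where P: "path_graph P" "v \<in> verts P"
    "\<forall>x\<in>verts P. \<forall>y. (x, y) \<in> arcs_ends F \<longrightarrow> (x, y) \<in> arcs_ends P \<and> y \<in> verts P"
    by (rule linear_forest_component[OF assms(1,2)])
  obtain p :: "'a \<Rightarrow> int" where p: "inj_on p (verts P)"
    "\<And>u v. (u, v) \<in> arcs_ends P \<Longrightarrow> \<bar>p u - p v\<bar> = 1"
    using path_graph_position[OF P(1)] by blast
  have mem: "x \<in> verts P" "y \<in> verts P" "z \<in> verts P" using P(2,3) assms(3-5) by blast+
  have "\<bar>p v - p x\<bar> = 1" "\<bar>p v - p y\<bar> = 1" "\<bar>p v - p z\<bar> = 1"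
    using P(2,3) assms(3-5) p(2) by blast+
  then have "p x = p y \<or> p x = p z \<or> p y = p z" by arith
  then show ?thesis using mem p(1) by (auto dest: inj_onD)
qed

text \<open>If \<open>x\<close> and \<open>y\<close> differ, they occupy both positions next to
  \<open>a\<close>, and the only position adjacent to both is that of \<open>a\<close> itself.
  Symmetry allows walking from \<open>x\<close> to \<open>b\<close>, which places \<open>b\<close>
  on the same path.\<close>

lemma linear_forest_no_4_cycle:
  fixes F :: "('a, 'b) pre_digraph"
  assumes "linear_forest F" "a \<in> verts F" "symmetric F"
    "(a, x) \<in> arcs_ends F" "(a, y) \<in> arcs_ends F" "(b, x) \<in> arcs_ends F" "(b, y) \<in> arcs_ends F"
  shows "a = b \<or> x = y"
proof -
  obtain P :: "('a, 'b) pre_digraph" where P: "path_graph P" "a \<in> verts P"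
    "\<forall>x\<in>verts P. \<forall>y. (x, y) \<in> arcs_ends F \<longrightarrow> (x, y) \<in> arcs_ends P \<and> y \<in> verts P"
    by (rule linear_forest_component[OF assms(1,2)])
  obtain p :: "'a \<Rightarrow> int" where p: "inj_on p (verts P)"
    "\<And>u v. (u, v) \<in> arcs_ends P \<Longrightarrow> \<bar>p u - p v\<bar> = 1"
    using path_graph_position[OF P(1)] by blast
  have sym: "(x, b) \<in> arcs_ends F" "(y, b) \<in> arcs_ends F"
    using assms(3,6,7) arcs_ends_symmetric by metis+
  have mem: "x \<in> verts P" "y \<in> verts P" using P(2,3) assms(4,5) by blast+
  moreover have b: "b \<in> verts P" using P(3) mem sym by blast
  moreover have "\<bar>p a - p x\<bar> = 1" "\<bar>p a - p y\<bar> = 1" "\<bar>p x - p b\<bar> = 1" "\<bar>p y - p b\<bar> = 1"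
    using P(2,3) assms(4,5) sym p(2) mem by blast+
  then have "p a = p b \<or> p x = p y" by arith
  ultimately show ?thesis using p(1) P(2) by (auto dest: inj_onD)
qed

section \<open>A sufficient condition for linear forests\<close>

text \<open>The decomposition is one path carrying all arcs, plus a one-vertex path for each
  remaining vertex. Allowing \<open>xs = []\<close> covers arcless graphs too.\<close>

lemma linear_forest_path_and_isolated:
  assumes F: "graph F" and xs: "distinct xs" "set xs \<subseteq> verts F"
    and arcs: "arcs_ends F = set (zip xs (tl xs)) \<union> (set (zip xs (tl xs)))\<inverse>"
  shows "linear_forest F"
proof -
  interpret graph F by fact
  define P where "P = F\<lparr>verts := set xs\<rparr>"
  define S where "S v = F\<lparr>verts := {v}, arcs := {}\<rparr>" for v
  \<comment> \<open>A path needs at least one vertex, so \<open>P\<close> is left out when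
    \<open>xs\<close> is empty.\<close>
  define Ps where "Ps = (if xs = [] then {} else {P}) \<union> S ` (verts F - set xs)"
  \<comment> \<open>\<open>P\<close> keeps all arcs of \<open>F\<close> on a smaller vertex set, so
    its well-formedness depends on this.\<close>
  have ends: "tail F e \<in> set xs" "head F e \<in> set xs" if "e \<in> arcs F" for e
  proof -
    have "(tail F e, head F e) \<in> arcs_ends F" using that by (auto simp: arcs_ends_conv)
    moreover have "set (tl xs) \<subseteq> set xs" by (cases xs) auto
    ultimately show "tail F e \<in> set xs" "head F e \<in> set xs"
      unfolding arcs by (auto dest: set_zip_leftD set_zip_rightD)
  qed
  have arcs_P: "arcs_ends P = arcs_ends F" by (simp add: P_def arcs_ends_conv)
  have P: "graph P"
    using ends no_loops no_multi_arcs sym_arcs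
    by unfold_locales (auto simp: P_def arc_to_ends_def symmetric_def arcs_ends_conv)
  have S: "graph (S v)" for v
    by unfold_locales (auto simp: S_def arc_to_ends_def symmetric_def arcs_ends_conv)
  have pathP: "path_graph P" if "xs \<noteq> []"
    using that P xs arcs unfolding path_graph_def arcs_P by (intro conjI exI[of _ xs]) (auto simp: P_def)
  have pathS: "path_graph (S v)" for v
    using S unfolding path_graph_def
    by (intro conjI exI[of _ "[v]"]) (auto simp: S_def arcs_ends_conv)
  have "wf_digraph P" "wf_digraph (S v)" for v
    using P S by (auto simp: graph_def digraph_def fin_digraph_def)
  then have sub: "subgraph P F" "v \<in> verts F \<Longrightarrow> subgraph (S v) F" for v
    using xs(2) wf_digraph by (auto simp: subgraph_def compatible_def P_def S_def)
  have empty: "arcs F = {}" if "xs = []" using ends that by auto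
  show ?thesis unfolding linear_forest_def
  proof (intro exI[of _ Ps] conjI ballI)
    show "path_graph Q" if "Q \<in> Ps" for Q
      using that pathP pathS by (auto simp: Ps_def split: if_splits)
    show "subgraph Q F" if "Q \<in> Ps" for Q
      using that sub by (auto simp: Ps_def split: if_splits)
    show "pairwise (\<lambda>P Q. verts P \<inter> verts Q = {}) Ps"
      by (auto simp: Ps_def pairwise_def P_def S_def)
    show "verts F = (\<Union>P\<in>Ps. verts P)"
      using xs(2) by (auto simp: Ps_def P_def S_def)
    show "arcs F = (\<Union>P\<in>Ps. arcs P)"
      using empty by (auto simp: Ps_def P_def S_def)
  qed
qed

lemma arcs_ends_with_proj_induce:
  "arcs_ends (with_proj G \<restriction> W) = {(u, v) \<in> parcs G. u \<in> W \<and> v \<in> W}"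
  by (auto simp: arcs_ends_conv)

section \<open>The complete bipartite graph with isolated vertices\<close>

text \<open>The sides are \<open>{0, 1}\<close> and \<open>{2, 3, 4}\<close>. The arcs do not depend
  on \<open>n\<close>, so the graphs are nested and \<open>K23_isolated 0\<close> is the complete
  bipartite graph itself.\<close>

definition K23_isolated :: "nat \<Rightarrow> nat pair_pre_digraph" where
  "K23_isolated n =
    \<lparr> pverts = {..<5 + n}, parcs = {0, 1} \<times> {2, 3, 4} \<union> {2, 3, 4} \<times> {0, 1} \<rparr>"

lemma K23_isolated_simps [simp]:
  "pverts (K23_isolated n) = {..<5 + n}"
  "parcs (K23_isolated n) = {0, 1} \<times> {2, 3, 4} \<union> {2, 3, 4} \<times> {0, 1}"
  by (simp_all add: K23_isolated_def)

lemma pair_graph_K23_isolated: "pair_graph (K23_isolated n)"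
  by unfold_locales (auto simp: symmetric_def sym_def)

lemma graph_K23_isolated: "graph (with_proj (K23_isolated n))"
  using pair_graph_K23_isolated by (rule pair_graph.pair_graphD_graph)

lemma subgraph_K23_isolated:
  "subgraph (with_proj (K23_isolated m)) (with_proj (K23_isolated n))" if "m \<le> n"
  using that pair_graph_K23_isolated
  by (auto simp: subgraph_def compatible_def wf_digraph_wp_iff pair_graph_def pair_digraph_def
      pair_fin_digraph_def)

lemma contains_K23_K23_isolated: "contains_K23 (with_proj (K23_isolated n))"
proof -
  have "complete_bipartite_digraph 2 3 (with_proj (K23_isolated 0))"
    unfolding complete_bipartite_digraph_pair_def
  proof (intro conjI exI)
    show "pverts (K23_isolated 0) = {0, 1} \<union> {2, 3, 4}" by auto
    show "parcs (K23_isolated 0) = {0, 1} \<times> {2, 3, 4} \<union> {2, 3, 4} \<times> {0, 1}" by simp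
  qed simp_all
  then show ?thesis
    unfolding contains_K23_def using subgraph_K23_isolated[of 0 n] by auto
qed

section \<open>Maximum degree and maximum average degree\<close>

lemma max_degree_K23_isolated: "max_degree (with_proj (K23_isolated n)) = 3"
proof -
  let ?G = "with_proj (K23_isolated n)"
  have out: "out_arcs ?G v = (if v \<in> {0, 1} then {v} \<times> {2, 3, 4}
      else if v \<in> {2, 3, 4} then {v} \<times> {0, 1} else {})" for v
    by (auto simp: out_arcs_def)
  have "out_degree ?G v \<le> 3" for v
    by (simp add: out_degree_def out card_cartesian_product)
  moreover have "out_degree ?G 0 = 3"
    by (simp add: out_degree_def out card_cartesian_product)
  then have "3 \<in> out_degree ?G ` verts ?G" by (intro image_eqI[of _ _ 0]) simp_all
  ultimately show ?thesis
    unfolding max_degree_def by (intro Max_eqI) auto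
qed

text \<open>This is the density bound for a bipartite graph with sides of sizes \<open>s\<close> and
  \<open>t\<close>. Equality at \<open>s = 2\<close>, \<open>t = 3\<close> is what makes 12/5 the
  exact value.\<close>

lemma five_prod_le_six_sum:
  fixes s t :: nat
  assumes "s \<le> 2" "t \<le> 3"
  shows "5 * (s * t) \<le> 6 * (s + t)"
proof -
  from assms(1) consider "s = 0" | "s = 1" | "s = 2" by linarith
  then show ?thesis using assms(2) by cases auto
qed

text \<open>Each edge of \<open>H\<close> joins \<open>A\<close> to \<open>B\<close>, so there are
  at most \<open>card A * card B\<close> edges, while \<open>A\<close> and \<open>B\<close> are
  disjoint sets of vertices of \<open>H\<close>.\<close>

lemma card_edges_subgraph_K23_isolated:
  assumes "subgraph H (with_proj (K23_isolated n))"
  shows "5 * card (edges H) \<le> 6 * card (verts H)"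
proof -
  interpret wf_digraph H using assms by (simp add: subgraph_def)
  have H: "verts H \<subseteq> {..<5 + n}" "arcs H \<subseteq> parcs (K23_isolated n)" "tail H = fst" "head H = snd"
    using assms by (auto simp: subgraph_def compatible_def)
  define A where "A = verts H \<inter> {0, 1}"
  define B where "B = verts H \<inter> {2, 3, 4}"
  have fin: "finite A" "finite B" "finite (verts H)"
    using H(1) finite_subset by (auto simp: A_def B_def)
  have "edges H \<subseteq> (\<lambda>(u, v). {u, v}) ` (A \<times> B)"
  proof
    fix X assume "X \<in> edges H"
    then obtain e where e: "e \<in> arcs H" "X = {fst e, snd e}"
      by (auto simp: edges_def arcs_ends_conv H)
    then have "fst e \<in> verts H" "snd e \<in> verts H"
      using wellformed H by metis+
    moreover have "e \<in> {0, 1} \<times> {2, 3, 4} \<union> {2, 3, 4} \<times> {0, 1}" using e H(2) by auto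
    \<comment> \<open>An arc may run in either direction; both give the same unordered pair.\<close>
    ultimately have "(fst e, snd e) \<in> A \<times> B \<or> (snd e, fst e) \<in> A \<times> B"
      by (cases e) (auto simp: A_def B_def)
    then show "X \<in> (\<lambda>(u, v). {u, v}) ` (A \<times> B)"
      using e(2) by (auto intro: rev_image_eqI simp: insert_commute)
  qed
  then have "card (edges H) \<le> card (A \<times> B)"
    by (rule surj_card_le[OF finite_cartesian_product[OF fin(1,2)]])
  then have "5 * card (edges H) \<le> 5 * (card A * card B)"
    by (simp add: card_cartesian_product)
  also have "\<dots> \<le> 6 * (card A + card B)"
  proof (rule five_prod_le_six_sum)
    have "card A \<le> card {0, 1 :: nat}" unfolding A_def by (intro card_mono) auto
    then show "card A \<le> 2" by simp
    have "card B \<le> card {2, 3, 4 :: nat}" unfolding B_def by (intro card_mono) auto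
    then show "card B \<le> 3" by simp
  qed
  also have "card A + card B = card (A \<union> B)"
    using fin by (intro card_Un_disjoint[symmetric]) (auto simp: A_def B_def)
  also have "\<dots> \<le> card (verts H)"
    using fin by (intro card_mono) (auto simp: A_def B_def)
  finally show ?thesis by simp
qed

lemma card_edges_K23_isolated: "card (edges (with_proj (K23_isolated n))) = 6"
proof -
  have "edges (with_proj (K23_isolated n)) =
      {{0, 2}, {0, 3}, {0, 4}, {1, 2}, {1, 3}, {1, 4}}"
    by (auto simp: edges_def image_Un insert_commute)
  then show ?thesis by (simp add: doubleton_eq_iff)
qed

lemma mad_K23_isolated: "mad (with_proj (K23_isolated n)) = 12 / 5"
proof -
  let ?G = "with_proj (K23_isolated n)"
  let ?M = "{2 * real (card (edges H)) / real (card (verts H)) | H.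
      graph H \<and> subgraph H ?G \<and> verts H \<noteq> {}}"
  \<comment> \<open>\<open>Max\<close> is meaningful only on a finite set; bounding numerators and
    denominators crudely is enough for that.\<close>
  have "?M \<subseteq> (\<lambda>(e, v). 2 * real e / real v) ` ({..6 * (5 + n)} \<times> {..5 + n})"
  proof clarify
    fix H :: "(nat, nat \<times> nat) pre_digraph"
    assume H: "subgraph H ?G"
    then have "card (verts H) \<le> card {..<5 + n}"
      by (intro card_mono) (auto simp: subgraph_def)
    moreover have "5 * card (edges H) \<le> 6 * card (verts H)"
      by (rule card_edges_subgraph_K23_isolated[OF H])
    ultimately show "2 * real (card (edges H)) / real (card (verts H))
        \<in> (\<lambda>(e, v). 2 * real e / real v) ` ({..6 * (5 + n)} \<times> {..5 + n})"
      by (intro image_eqI[of _ _ "(card (edges H), card (verts H))"]) auto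
  qed
  then have "finite ?M" by (rule finite_subset) simp
  moreover have "x \<le> 12 / 5" if "x \<in> ?M" for x
  proof -
    from that obtain H where H: "graph H" "subgraph H ?G" "verts H \<noteq> {}"
      "x = 2 * real (card (edges H)) / real (card (verts H))" by blast
    interpret graph H by fact
    have "0 < card (verts H)" using H(3) by (simp add: card_gt_0_iff)
    moreover have "real (5 * card (edges H)) \<le> real (6 * card (verts H))"
      using card_edges_subgraph_K23_isolated[OF H(2)] by (simp only: of_nat_le_iff)
    ultimately show ?thesis by (simp add: H(4) field_simps)
  qed
  \<comment> \<open>The value is attained at \<open>K23_isolated 0\<close>, with 6 edges on 5
    vertices.\<close>
  moreover have "12 / 5 \<in> ?M"
    using graph_K23_isolated[of 0] subgraph_K23_isolated[of 0 n] card_edges_K23_isolated[of 0]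
    by (intro CollectI exI[of _ "with_proj (K23_isolated 0)"]) (auto simp: lessThan_empty_iff)
  ultimately show ?thesis unfolding mad_def by (intro Max_eqI) auto
qed

section \<open>The linear chromatic number\<close>

text \<open>Covering every \<open>k\<close> up to 3 at once gives minimality directly, without
  showing that colorability is monotone in \<open>k\<close>.\<close>

lemma no_linear_3_coloring_K23_isolated:
  assumes "k \<le> 3"
  shows "\<not> linear_coloring (with_proj (K23_isolated n)) k c"
proof
  let ?G = "with_proj (K23_isolated n)"
  let ?F = "\<lambda>i j. ?G \<restriction> {v \<in> verts ?G. c v = i \<or> c v = j}"
  assume "linear_coloring ?G k c"
  then have col: "\<And>v. v < 5 + n \<Longrightarrow> c v < k"
    and proper: "\<And>u v. (u, v) \<in> parcs (K23_isolated n) \<Longrightarrow> c u \<noteq> c v"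
    and lin: "\<And>i j. i < k \<Longrightarrow> j < k \<Longrightarrow> i \<noteq> j \<Longrightarrow> linear_forest (?F i j)"
    by (auto simp: linear_coloring_def proper_coloring_def simp del: K23_isolated_simps(2))
  have neq: "c 0 \<noteq> c 2" "c 0 \<noteq> c 3" "c 0 \<noteq> c 4" "c 1 \<noteq> c 2" "c 1 \<noteq> c 3" "c 1 \<noteq> c 4"
    using proper by auto
  have lt: "c 0 < k" "c 1 < k" "c 2 < k" "c 3 < k" "c 4 < k" using col by auto
  have adj: "(u, v) \<in> arcs_ends (?F i j) \<longleftrightarrow> (u, v) \<in> parcs (K23_isolated n)
      \<and> (c u = i \<or> c u = j) \<and> (c v = i \<or> c v = j)" for u v i j
    using col unfolding arcs_ends_with_proj_induce by auto
  have sym: "symmetric (?F i j)" for i j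
    unfolding symmetric_def sym_def adj by auto
  show False
  proof (cases "c 0 = c 1")
    case True
    \<comment> \<open>The bicolored cycle is 0, \<open>x\<close>, 1, \<open>y\<close>.\<close>
    have cycle: False if xy: "x \<in> {2, 3, 4}" "y \<in> {2, 3, 4}" "x \<noteq> y" "c x = c y" for x y
    proof -
      have "c 0 \<noteq> c x" "c x < k" using xy(1) neq lt by auto
      then have "linear_forest (?F (c 0) (c x))" using lin lt by blast
      then have "(0 :: nat) = 1 \<or> x = y"
        by (rule linear_forest_no_4_cycle) (use True xy sym adj in auto)
      then show False using xy by simp
    qed
    \<comment> \<open>At most two colors remain for three vertices.\<close>
    have "c 2 = c 3 \<or> c 2 = c 4 \<or> c 3 = c 4"
      using neq lt assms True by linarith
    then show False using cycle[of 2 3] cycle[of 2 4] cycle[of 3 4] by auto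
  next
    case False
    \<comment> \<open>Vertices 0 and 1 use two colors, which leaves one for 2, 3 and 4; the claw is
      centered at 0.\<close>
    then have eq: "c 2 = c 3" "c 3 = c 4" using neq lt assms by linarith+
    have "linear_forest (?F (c 0) (c 2))" using lin lt neq by blast
    then have "(2 :: nat) = 3 \<or> (2 :: nat) = 4 \<or> (3 :: nat) = 4"
      by (rule linear_forest_no_claw[where v = 0]) (use eq adj in auto)
    then show False by simp
  qed
qed

text \<open>Vertices 2, 3, 4 get the private colors 1, 2, 3 and all others get 0. Color 0 together
  with \<open>j\<close> induces the path 0, \<open>Suc j\<close>, 1 and isolated vertices; two
  nonzero colors induce no arcs.\<close>

lemma linear_4_coloring_K23_isolated:
  "linear_coloring (with_proj (K23_isolated n)) 4 (\<lambda>v. if v \<in> {2, 3, 4} then v - 1 else 0)"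
  (is "linear_coloring ?G 4 ?c")
proof -
  let ?W = "\<lambda>i j. {v \<in> verts ?G. ?c v = i \<or> ?c v = j}"
  have graph: "graph (?G \<restriction> ?W i j)" for i j
  proof -
    interpret graph ?G by (rule graph_K23_isolated)
    have ind: "induced_subgraph (?G \<restriction> ?W i j) ?G" by (rule induced_induce) auto
    show ?thesis
      using digraphI_induced[OF ind] induced_graph_imp_symmetric[OF sym_arcs ind]
      by (rule digraph.graphI)
  qed
  have zero: "linear_forest (?G \<restriction> ?W 0 j)" if "j \<noteq> 0" "j < 4" for j
  proof (rule linear_forest_path_and_isolated[OF graph, of "[0, Suc j, 1]"])
    consider "j = 1" | "j = 2" | "j = 3" using \<open>j \<noteq> 0\<close> \<open>j < 4\<close> by linarith
    note j = this
    show "distinct [0, Suc j, 1]" using j by cases simp_all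
    show "set [0, Suc j, 1] \<subseteq> verts (?G \<restriction> ?W 0 j)" using j by cases simp_all
    show "arcs_ends (?G \<restriction> ?W 0 j) = set (zip [0, Suc j, 1] (tl [0, Suc j, 1]))
        \<union> (set (zip [0, Suc j, 1] (tl [0, Suc j, 1])))\<inverse>"
    proof -
      \<comment> \<open>If all of one side and a single vertex \<open>m\<close> of the other
        survive, a star around \<open>m\<close> remains; with two leaves it is a path.\<close>
      have restrict: "{(u, v) \<in> A \<times> B \<union> B \<times> A. u \<in> W \<and> v \<in> W} = A \<times> {m} \<union> {m} \<times> A"
        if "A \<subseteq> W" "B \<inter> W = {m}" for A B W :: "nat set" and m
        using that by auto
      have "{0, 1} \<subseteq> ?W 0 j" by simp
      moreover have "{2, 3, 4} \<inter> ?W 0 j = {Suc j}"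
        using j by cases (simp_all add: Int_insert_left)
      ultimately have "arcs_ends (?G \<restriction> ?W 0 j) = {0, 1} \<times> {Suc j} \<union> {Suc j} \<times> {0, 1}"
        unfolding arcs_ends_with_proj_induce K23_isolated_simps(2) by (rule restrict)
      then show ?thesis by auto
    qed
  qed
  have nonzero: "linear_forest (?G \<restriction> ?W i j)" if "i \<noteq> 0" "j \<noteq> 0" for i j
  proof (rule linear_forest_path_and_isolated[OF graph, of "[]"])
    show "arcs_ends (?G \<restriction> ?W i j) = set (zip [] (tl [])) \<union> (set (zip [] (tl [])))\<inverse>"
      using that unfolding arcs_ends_with_proj_induce by auto
  qed simp_all
  have "linear_forest (?G \<restriction> ?W i j)" if "i < 4" "j < 4" "i \<noteq> j" for i j
  proof -
    consider "i = 0" | "j = 0" | "i \<noteq> 0" "j \<noteq> 0" by blast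
    then show ?thesis
    proof cases
      case 1
      then show ?thesis using zero[of j] that by simp
    next
      case 2
      then have "linear_forest (?G \<restriction> ?W j i)" using zero[of i] that by simp
      moreover have "?W i j = ?W j i" by (simp only: disj_commute)
      ultimately show ?thesis by (simp only:)
    next
      case 3
      then show ?thesis by (rule nonzero)
    qed
  qed
  moreover have "proper_coloring ?G 4 ?c"
    by (auto simp: proper_coloring_def)
  ultimately show ?thesis by (simp add: linear_coloring_def)
qed

lemma linear_chromatic_number_K23_isolated:
  "linear_chromatic_number (with_proj (K23_isolated n)) = 4"
  unfolding linear_chromatic_number_def
proof (rule Least_equality)
  show "\<exists>c. linear_coloring (with_proj (K23_isolated n)) 4 c"
    using linear_4_coloring_K23_isolated by blast
  show "4 \<le> k" if "\<exists>c. linear_coloring (with_proj (K23_isolated n)) k c" for k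
    using that no_linear_3_coloring_K23_isolated[of k n] by (cases "k \<le> 3") auto
qed

section \<open>Infinitely many isomorphism classes\<close>

text \<open>An isomorphism is injective on vertices. The vertex count \<open>5 + n\<close> therefore
  separates the members of the family.\<close>

lemma digraph_iso_card_verts:
  assumes "digraph_iso G H"
  shows "card (verts G) = card (verts H)"
  using assms
  by (auto simp: digraph_iso_def verts_app_iso pre_digraph.digraph_isomorphism_def card_image)

theorem mainTheorem3:
  shows "\<exists>\<G> :: nat pair_pre_digraph set.
    infinite \<G> \<and>
    pairwise (\<lambda>G H. \<not> digraph_iso (with_proj G) (with_proj H)) \<G> \<and>
    (\<forall>G\<in>\<G>. pair_graph G \<and>
        contains_K23 (with_proj G) \<and>
        max_degree (with_proj G) \<le> 4 \<and>
        mad (with_proj G) = 12 / 5 \<and>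
        int (linear_chromatic_number (with_proj G))
          = \<lceil>real (max_degree (with_proj G)) / 2\<rceil> + 2)"
proof (intro exI[of _ "range K23_isolated"] conjI)
  have noniso: "m = n" if "digraph_iso (with_proj (K23_isolated m)) (with_proj (K23_isolated n))"
    for m n
    using digraph_iso_card_verts[OF that] by simp
  show "pairwise (\<lambda>G H. \<not> digraph_iso (with_proj G) (with_proj H)) (range K23_isolated)"
    using noniso by (auto simp: pairwise_def)
  have "inj K23_isolated"
  proof (rule injI)
    fix m n assume "K23_isolated m = K23_isolated n"
    then have "pverts (K23_isolated m) = pverts (K23_isolated n)" by (rule arg_cong)
    then show "m = n" by simp
  qed
  then show "infinite (range K23_isolated)" by (rule range_inj_infinite)
  \<comment> \<open>With maximum degree 3 the required value is 2 + 2, the linear chromatic number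
    found above.\<close>
  have "\<lceil>3 / 2 :: real\<rceil> = 2" by (simp add: ceiling_eq_iff)
  then show "\<forall>G\<in>range K23_isolated. pair_graph G \<and>
        contains_K23 (with_proj G) \<and>
        max_degree (with_proj G) \<le> 4 \<and>
        mad (with_proj G) = 12 / 5 \<and>
        int (linear_chromatic_number (with_proj G))
          = \<lceil>real (max_degree (with_proj G)) / 2\<rceil> + 2"
    by (auto simp: pair_graph_K23_isolated contains_K23_K23_isolated max_degree_K23_isolated
        mad_K23_isolated linear_chromatic_number_K23_isolated)
qed

end
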